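(* Let $i\in\{0,1,2,3\}$ and let $G$ be a graph in the class $\varepsilon_i$. Then $G$ is regular if and only if $G$ is regular of degree two, i.e. $G$ is a cycle graph $C_n$ (with $n\equiv i \pmod 4$).
   Context: All graphs are finite, simple, undirected and connected. An Euler graph is a connected graph in which every vertex has even degree. For $i\in\{0,1,2,3\}$, $\varepsilon_i$ denotes the class of Euler graphs $G$ such that every cycle of $G$ has length $n\equiv i \pmod 4$. A cycle graph is a graph consisting of a single cycle.
   Formalization: The graph G is assumed to have more than one vertex; the one-vertex graph is connected with even degree 0 and no cycles, so it lies in every class ε_i and is regular of degree 0 but not of degree two. *)

theory Defs
  imports "Graph_Theory.Graph_Theory" "HOL-Number_Theory.Cong"
begin

text \<open>
  Finite simple undirected graphs are rendered as \<^locale>\<open>pair_graph\<close>: finite, loop-free, symmetric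
  digraphs without parallel arcs, where each edge is represented by its two opposite arcs.
\<close>

text \<open>By symmetry, the out-degree of a vertex is its degree in the undirected graph.\<close>

definition vertex_degree :: "'a pair_pre_digraph \<Rightarrow> 'a \<Rightarrow> nat" where
  "vertex_degree G v = out_degree (with_proj G) v"

definition regular_of_degree :: "'a pair_pre_digraph \<Rightarrow> nat \<Rightarrow> bool" where
  "regular_of_degree G k \<longleftrightarrow> (\<forall>v \<in> pverts G. vertex_degree G v = k)"

definition regular :: "'a pair_pre_digraph \<Rightarrow> bool" where
  "regular G \<longleftrightarrow> (\<exists>k. regular_of_degree G k)"

text \<open>
  In a symmetric digraph the closed walk \<open>u, v, u\<close> along a single edge is a directed cycle of length
  two, but it is not a cycle of the undirected graph; hence the bound on the length.
\<close>

definition undirected_cycle :: "'a pair_pre_digraph \<Rightarrow> ('a \<times> 'a) awalk \<Rightarrow> bool" where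
  "undirected_cycle G p \<longleftrightarrow> pre_digraph.cycle (with_proj G) p \<and> 3 \<le> length p"

definition euler_graph :: "'a pair_pre_digraph \<Rightarrow> bool" where
  "euler_graph G \<longleftrightarrow>
     pair_graph G \<and> connected (with_proj G) \<and> (\<forall>v \<in> pverts G. even (vertex_degree G v))"

definition euler_class :: "nat \<Rightarrow> 'a pair_pre_digraph set" (\<open>\<epsilon>\<close>) where
  "\<epsilon> i = {G. euler_graph G \<and> (\<forall>p. undirected_cycle G p \<longrightarrow> [length p = i] (mod 4))}"

text \<open>The standard cycle \<open>C\<^sub>n\<close>; it is a simple graph only for \<open>n \<ge> 3\<close>.\<close>

definition cycle_graph :: "nat \<Rightarrow> nat pair_pre_digraph" where
  "cycle_graph n = \<lparr> pverts = {..<n},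
     parcs = {(u, v). u < n \<and> v < n \<and> (v = Suc u mod n \<or> u = Suc v mod n)} \<rparr>"

lemma pair_graph_cycle_graph:
  assumes "3 \<le> n"
  shows "pair_graph (cycle_graph n)"
proof -
  have "finite (parcs (cycle_graph n))"
    by (rule finite_subset[of _ "{..<n} \<times> {..<n}"]) (auto simp: cycle_graph_def)
  moreover have "Suc u mod n \<noteq> u" "u \<noteq> Suc u mod n" if "u < n" for u
    using that assms by (auto simp: mod_Suc)
  ultimately show ?thesis
    by unfold_locales (auto simp: cycle_graph_def symmetric_def sym_def)
qed

end

theory Submission
  imports Defs
begin

text \<open>
  Regularity of odd degree and degree 0 are excluded at once, so the point is that minimum degree 3 is
  impossible. Among all longest paths \<open>v 0, \<dots>, v m\<close> and all chords \<open>v 0 - v a\<close> with \<open>a \<ge> 2\<close>, choose one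
  with \<open>a\<close> minimal. A second chord \<open>v 0 - v b\<close> gives cycles of lengths \<open>a + 1\<close>, \<open>b + 1\<close> and \<open>b - a + 2\<close>,
  which forces \<open>i = 2\<close> and \<open>a = b = 1\<close> modulo 4. Rotating the path along the first chord makes
  \<open>v (a - 1)\<close> the start of a longest path; by minimality its third neighbour is some \<open>v x\<close> with
  \<open>x > a\<close>, and \<open>x = 1\<close> modulo 4. The cycle \<open>v 0, v a, v (a - 1), v x, \<dots>, v b\<close> then has length
  \<open>\<bar>x - b\<bar> + 4\<close>, a multiple of 4, contradicting \<open>i = 2\<close>. In the 2-regular case a longest path closes
  up to a cycle through all vertices.
\<close>

section \<open>Cycles from vertex lists\<close>

lemma pcas_zip_tl:
  assumes "us \<noteq> []"
  shows "pcas (hd us) (zip us (tl us @ [w])) w"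
  using assms
proof (induction us)
  case (Cons a us)
  then show ?case by (cases us) auto
qed simp

lemma set_zip_tl_subset:
  assumes "us \<noteq> []" "successively (\<lambda>x y. (x, y) \<in> R) us" "(last us, w) \<in> R"
  shows "set (zip us (tl us @ [w])) \<subseteq> R"
  using assms
proof (induction us)
  case (Cons a us)
  then show ?case by (cases us) auto
qed simp

lemma (in pair_wf_digraph) undirected_cycle_of_vertices:
  assumes "distinct us" "3 \<le> length us" "successively (\<lambda>x y. (x, y) \<in> parcs G) us"
    and "(last us, hd us) \<in> parcs G"
  shows "\<exists>p. undirected_cycle G p \<and> length p = length us"
proof -
  define p where "p = zip us (tl us @ [hd us])"
  have ne: "us \<noteq> []" using assms(2) by auto
  have len: "length p = length us" using ne by (simp add: p_def)
  have cas: "pcas (hd us) p (hd us)" unfolding p_def by (rule pcas_zip_tl[OF ne])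
  have arcs: "set p \<subseteq> parcs G" unfolding p_def by (rule set_zip_tl_subset[OF ne assms(3,4)])
  have "hd us \<in> pverts G" using assms(4) by (rule in_arcsD2)
  then have walk: "awalk (hd us) p (hd us)" unfolding awalk_def using arcs cas by simp
  have "p \<noteq> []" using len ne by auto
  \<comment> \<open>\<open>cycle\<close> asks for distinctness only after the first vertex is
    dropped; what is left is \<open>us\<close> rotated by one place.\<close>
  then have "pawalk_verts (hd us) p = fst (hd p) # map snd p"
    using awalk_verts_conv'[of "hd us" p "hd us"] cas by simp
  also have "map snd p = tl us @ [hd us]" using ne by (simp add: p_def)
  finally have "distinct (tl (pawalk_verts (hd us) p))"
    using assms(1) ne by (cases us) auto
  then have "cycle p" unfolding cycle_def using walk \<open>p \<noteq> []\<close> by auto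
  then show ?thesis using len assms(2) by (auto simp: undirected_cycle_def)
qed

section \<open>Longest paths\<close>

text \<open>Numbering the vertices by a function lets cycles be given as lists of indices.
  \<open>m\<close> counts edges, and \<open>v\<close> is arbitrary beyond \<open>m\<close>.\<close>

definition path_on :: "'a pair_pre_digraph \<Rightarrow> (nat \<Rightarrow> 'a) \<Rightarrow> nat \<Rightarrow> bool" where
  "path_on G v m \<longleftrightarrow> inj_on v {..m} \<and> v ` {..m} \<subseteq> pverts G \<and>
     (\<forall>k<m. (v k, v (Suc k)) \<in> parcs G)"

text \<open>Longest in the whole graph, not merely inextensible at its ends: any other path with the
  same \<open>m\<close> is then longest too, which rotation relies on.\<close>

definition longest_path :: "'a pair_pre_digraph \<Rightarrow> (nat \<Rightarrow> 'a) \<Rightarrow> nat \<Rightarrow> bool" where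
  "longest_path G v m \<longleftrightarrow> path_on G v m \<and> (\<forall>v' m'. path_on G v' m' \<longrightarrow> m' \<le> m)"

lemma vertex_degree_eq: "vertex_degree G u = card {w. (u, w) \<in> parcs G}"
proof -
  have "out_arcs (with_proj G) u = Pair u ` {w. (u, w) \<in> parcs G}"
    by (auto simp: out_arcs_def)
  then show ?thesis
    by (simp add: vertex_degree_def out_degree_def card_image inj_on_def)
qed

text \<open>Adding \<open>m\<close> modulo \<open>Suc m\<close> expresses the cyclic predecessor
  without a special case at index 0.\<close>

lemma pred_mod_Suc:
  fixes k m :: nat
  assumes "k \<le> m"
  shows "(k + m) mod Suc m = (if k = 0 then m else k - 1)"
proof (cases k)
  case (Suc j)
  then have "k + m = j + Suc m" by simp
  then show ?thesis using assms Suc by (simp only: mod_add_self2) simp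
qed simp

context pair_graph
begin

lemma finite_neighbours: "finite {w. (u, w) \<in> parcs G}"
  by (rule finite_subset[OF _ pair_finite_verts]) (auto dest: in_arcsD2)

lemma longest_path_exists:
  assumes "pverts G \<noteq> {}"
  obtains v m where "longest_path G v m"
proof -
  obtain u where "u \<in> pverts G" using assms by auto
  then have ex: "path_on G (\<lambda>_. u) 0" by (auto simp: path_on_def)
  have bound: "m \<le> card (pverts G)" if "path_on G v m" for v m
  proof -
    have "card {..m} \<le> card (pverts G)"
      using that pair_finite_verts by (intro card_inj_on_le[of v]) (auto simp: path_on_def)
    then show ?thesis by simp
  qed
  define P where "P = (\<lambda>m. \<exists>v. path_on G v m)"
  have "P 0" using ex by (auto simp: P_def)
  have P_bound: "m \<le> card (pverts G)" if "P m" for m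
    using that bound by (auto simp: P_def)
  have "P (Greatest P)" using \<open>P 0\<close> P_bound by (rule GreatestI_nat)
  then obtain v where "path_on G v (Greatest P)" by (auto simp: P_def)
  moreover have "m \<le> Greatest P" if "path_on G v' m" for v' m
  proof (rule Greatest_le_nat[of P])
    show "P m" using that by (auto simp: P_def)
  qed (rule P_bound)
  ultimately show ?thesis using that by (auto simp: longest_path_def)
qed

text \<open>A neighbour off the path could be put in front of it, as \<open>case_nat w v\<close>,
  giving a longer path.\<close>

lemma longest_path_neighbour:
  assumes "longest_path G v m" "(v 0, w) \<in> parcs G"
  obtains k where "1 \<le> k" "k \<le> m" "w = v k"
proof -
  have p: "path_on G v m" using assms(1) by (simp add: longest_path_def)
  have "w \<in> v ` {..m}"
  proof (rule ccontr)
    assume new: "w \<notin> v ` {..m}"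
    have "inj_on (case_nat w v) {..Suc m}"
      using p new unfolding path_on_def inj_on_def
      by (auto split: nat.splits)
    moreover have "case_nat w v ` {..Suc m} \<subseteq> pverts G"
      using p in_arcsD2[OF assms(2)] by (auto simp: path_on_def image_subset_iff split: nat.splits)
    moreover have "(case_nat w v k, case_nat w v (Suc k)) \<in> parcs G" if "k < Suc m" for k
      using that p assms(2) arcs_symmetric by (auto simp: path_on_def split: nat.splits)
    ultimately have "path_on G (case_nat w v) (Suc m)" by (simp add: path_on_def)
    then show False using assms(1) unfolding longest_path_def by fastforce
  qed
  then obtain k where k: "k \<le> m" "w = v k" by auto
  then have "k \<noteq> 0" using assms(2) no_loops' by metis
  then show ?thesis using k that[of k] by simp
qed

text \<open>Posa rotation: the chord \<open>v 0 - v a\<close> replaces the path edge \<open>v (a - 1) - v a\<close>.\<close>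

lemma longest_path_rotate:
  assumes "longest_path G v m" "(v 0, v a) \<in> parcs G" "1 \<le> a" "a \<le> m"
  shows "longest_path G (\<lambda>k. if k < a then v (a - 1 - k) else v k) m"
proof -
  let ?f = "\<lambda>k. if k < a then a - 1 - k else k"
  let ?w = "\<lambda>k. if k < a then v (a - 1 - k) else v k"
  have p: "path_on G v m" using assms(1) by (simp add: longest_path_def)
  have w: "?w = v \<circ> ?f" by auto
  have f: "inj_on ?f {..m}" "?f ` {..m} \<subseteq> {..m}"
    using assms(3,4) by (auto simp: inj_on_def split: if_splits)
  have "inj_on (v \<circ> ?f) {..m}"
    using p f by (intro comp_inj_on) (auto simp: path_on_def intro: inj_on_subset)
  moreover have "(v \<circ> ?f) ` {..m} \<subseteq> pverts G"
    using p f unfolding path_on_def by fastforce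
  moreover have "(?w k, ?w (Suc k)) \<in> parcs G" if k: "k < m" for k
  proof -
    \<comment> \<open>The reversed initial segment, the chord \<open>v 0 - v a\<close> as the only
      new edge, and the unchanged tail.\<close>
    consider "Suc k < a" | "Suc k = a" | "a \<le> k" by linarith
    then show ?thesis
    proof cases
      case 1
      then have "(v (a - 2 - k), v (Suc (a - 2 - k))) \<in> parcs G"
        using p assms(4) by (auto simp: path_on_def)
      moreover have "Suc (a - 2 - k) = a - 1 - k" "a - 2 - k = a - 1 - Suc k"
        using 1 by auto
      ultimately show ?thesis using 1 arcs_symmetric by simp
    next
      case 2
      then show ?thesis using assms(2) by auto
    next
      case 3
      then show ?thesis using p k by (auto simp: path_on_def)
    qed
  qed
  ultimately have "path_on G ?w m" unfolding path_on_def w[symmetric] by blast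
  then show ?thesis using assms(1) by (simp add: longest_path_def)
qed

section \<open>Cycles assembled from segments of a path\<close>

lemma path_on_adjacent:
  assumes "path_on G v m" "x \<le> m" "y \<le> m" "y = Suc x \<or> x = Suc y"
  shows "(v x, v y) \<in> parcs G"
  using assms arcs_symmetric by (auto simp: path_on_def)

lemma successively_segment:
  assumes "path_on G v m" "b \<le> m"
  shows "successively (\<lambda>x y. (v x, v y) \<in> parcs G) [a..<Suc b]"
  unfolding successively_conv_nth
  using assms by (auto intro!: path_on_adjacent[OF assms(1)] simp del: upt_Suc)

lemma successively_rev_segment:
  assumes "path_on G v m" "b \<le> m"
  shows "successively (\<lambda>x y. (v x, v y) \<in> parcs G) (rev [a..<Suc b])"
  unfolding successively_rev
  using successively_segment[OF assms] by (rule successively_mono) (auto intro: arcs_symmetric)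

text \<open>Since \<open>v\<close> is injective on the path, a cycle can be checked on its indices,
  where distinctness and length are plain arithmetic.\<close>

lemma index_cycle_length:
  assumes cyc: "\<And>p. undirected_cycle G p \<Longrightarrow> [length p = i] (mod 4)"
    and p: "path_on G v m"
    and ns: "distinct ns" "set ns \<subseteq> {..m}" "3 \<le> length ns"
    and adj: "successively (\<lambda>x y. (v x, v y) \<in> parcs G) ns" "(v (last ns), v (hd ns)) \<in> parcs G"
  shows "[length ns = i] (mod 4)"
proof -
  have ne: "ns \<noteq> []" using ns by auto
  have "distinct (map v ns)"
    using ns p by (auto simp: distinct_map path_on_def intro: inj_on_subset)
  then obtain q where "undirected_cycle G q" "length q = length ns"
    using undirected_cycle_of_vertices[of "map v ns"] ns adj ne
    by (auto simp: successively_map last_map hd_map)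
  then show ?thesis using cyc by metis
qed

text \<open>The chord closes the initial segment \<open>v 0, ..., v a\<close>, which has
  \<open>a + 1\<close> vertices.\<close>

lemma chord_cycle_length:
  assumes cyc: "\<And>p. undirected_cycle G p \<Longrightarrow> [length p = i] (mod 4)"
    and p: "path_on G v m"
    and a: "2 \<le> a" "a \<le> m" "(v 0, v a) \<in> parcs G"
  shows "[a + 1 = i] (mod 4)"
proof -
  have "[length [0..<Suc a] = i] (mod 4)"
    using a arcs_symmetric
    by (intro index_cycle_length[OF cyc p] successively_segment[OF p]) auto
  then show ?thesis by simp
qed

section \<open>Minimum degree three is impossible\<close>

lemma third_neighbour:
  assumes "3 \<le> vertex_degree G u"
  obtains w where "(u, w) \<in> parcs G" "w \<noteq> x" "w \<noteq> y"
proof -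
  have "\<not> {w. (u, w) \<in> parcs G} \<subseteq> {x, y}"
  proof
    assume "{w. (u, w) \<in> parcs G} \<subseteq> {x, y}"
    then have "vertex_degree G u \<le> card {x, y}"
      unfolding vertex_degree_eq by (intro card_mono) auto
    also have "\<dots> \<le> 2" by (simp add: card_insert_if)
    finally show False using assms by simp
  qed
  then show ?thesis using that by auto
qed

lemma minimum_degree_3_contradiction:
  assumes cyc: "\<And>p. undirected_cycle G p \<Longrightarrow> [length p = i] (mod 4)"
    and deg: "\<And>u. u \<in> pverts G \<Longrightarrow> 3 \<le> vertex_degree G u"
    and ne: "pverts G \<noteq> {}"
  shows False
proof -
  \<comment> \<open>The path is quantified inside \<open>Q\<close>, so minimality of
    \<open>a\<close> also applies to chords of the rotated path.\<close>
  define Q where "Q = (\<lambda>a. \<exists>v m. longest_path G v m \<and> 2 \<le> a \<and> a \<le> m \<and> (v 0, v a) \<in> parcs G)"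
  have start: "3 \<le> vertex_degree G (v k)" if "longest_path G v m" "k \<le> m" for v m k
    using that deg by (auto simp: longest_path_def path_on_def)
  \<comment> \<open>The index \<open>a\<close> is arbitrary: the first use needs just some chord,
    the second one different from the minimal chord.\<close>
  have chord: "\<exists>k. k \<noteq> a \<and> 2 \<le> k \<and> k \<le> m \<and> (v 0, v k) \<in> parcs G"
    if l: "longest_path G v m" for v m a
  proof -
    obtain w where w: "(v 0, w) \<in> parcs G" "w \<noteq> v 1" "w \<noteq> v a"
      using third_neighbour[OF start[OF l]] by blast
    then obtain k where "1 \<le> k" "k \<le> m" "w = v k" using longest_path_neighbour[OF l] by blast
    moreover have "k \<noteq> 1" using calculation w by auto
    ultimately show ?thesis using w by (intro exI[of _ k]) auto
  qed
  obtain v0 m0 where "longest_path G v0 m0" using longest_path_exists ne by blast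
  then have "\<exists>a. Q a" using chord unfolding Q_def by blast
  then obtain a where Qa: "Q a" and least: "\<And>k. Q k \<Longrightarrow> a \<le> k"
    by (metis LeastI_ex Least_le)
  obtain v m where l: "longest_path G v m" and a: "2 \<le> a" "a \<le> m" "(v 0, v a) \<in> parcs G"
    using Qa by (auto simp: Q_def)
  have p: "path_on G v m" using l by (simp add: longest_path_def)
  obtain b where "b \<noteq> a" and b: "2 \<le> b" "b \<le> m" "(v 0, v b) \<in> parcs G"
    using chord[OF l] by blast
  moreover have "Q b" using b l by (auto simp: Q_def)
  ultimately have ab: "a < b" using least by (metis le_neq_implies_less)
  have ai: "[a + 1 = i] (mod 4)" and bi: "[b + 1 = i] (mod 4)"
    using chord_cycle_length[OF cyc p] a b by blast+
  \<comment> \<open>This cycle leaves \<open>v 0\<close> by one chord, follows the path from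
    \<open>v a\<close> to \<open>v b\<close> and returns by the other chord.\<close>
  have "[length (0 # [a..<Suc b]) = i] (mod 4)"
    using ab a b arcs_symmetric successively_segment[OF p b(2)]
    by (intro index_cycle_length[OF cyc p]) (auto simp: successively_Cons simp del: upt_Suc)
  then have abi: "[b - a + 2 = i] (mod 4)" using ab by (simp add: Suc_diff_le)
  \<comment> \<open>The two chord cycles give \<open>b - a = 0\<close> modulo 4; the cycle through
    both chords then forces \<open>i = 2\<close>.\<close>
  have "[(a + 1) + (b - a) = (a + 1) + 0] (mod 4)"
    using ai bi ab by (auto simp: cong_def)
  then have "[b - a = 0] (mod 4)" by (simp only: cong_add_lcancel_nat)
  then have "[b - a + 2 = 0 + 2] (mod 4)" by (rule cong_add) simp
  then have i: "i mod 4 = 2" using abi by (simp add: cong_def)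
  have chord_mod: "k mod 4 = 1" if "[k + 1 = i] (mod 4)" for k
    using that unfolding cong_def i by presburger
  have a4: "a mod 4 = 1" and b4: "b mod 4 = 1" using chord_mod ai bi by blast+
  have a5: "5 \<le> a" using a a4 by presburger

  let ?w = "\<lambda>k. if k < a then v (a - 1 - k) else v k"
  have lw: "longest_path G ?w m" using longest_path_rotate[OF l a(3)] a by simp
  have pw: "path_on G ?w m" using lw by (simp add: longest_path_def)
  \<comment> \<open>Here \<open>?w 0\<close> is \<open>v (a - 1)\<close>. Excluding
    \<open>?w a\<close>, which is \<open>v a\<close>, discards the path edge removed by the
    rotation; it is a chord of index exactly \<open>a\<close>. So minimality yields
    \<open>a < x\<close> strictly, where \<open>?w\<close> and \<open>v\<close> agree.\<close>
  obtain y where y: "(?w 0, y) \<in> parcs G" "y \<noteq> ?w 1" "y \<noteq> ?w a"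
    using third_neighbour[OF start[OF lw]] by blast
  obtain x where x: "1 \<le> x" "x \<le> m" "y = ?w x"
    using longest_path_neighbour[OF lw y(1)] by blast
  have "x \<noteq> 1" "x \<noteq> a" using x(3) y(2,3) by blast+
  then have "Q x" using lw x y(1) unfolding Q_def by (intro exI[of _ ?w] exI[of _ m]) auto
  then have xa: "a < x" using least \<open>x \<noteq> a\<close> by (metis le_neq_implies_less)
  have wx: "(v (a - 1), v x) \<in> parcs G" using y(1) x(3) xa a5 by simp
  have "[x + 1 = i] (mod 4)"
    using chord_cycle_length[OF cyc pw, of x] x xa a5 wx by simp
  then have x4: "x mod 4 = 1" by (rule chord_mod)
  have a1: "(v a, v (a - 1)) \<in> parcs G" using path_on_adjacent[OF p] a by auto

  show False
  proof (cases "x \<le> b")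
    case True
    \<comment> \<open>Chord to \<open>v a\<close>, one path edge back, the chord of the rotated path
      to \<open>v x\<close>, along the path to \<open>v b\<close>, and the second chord home. For
      \<open>x = b\<close> this is a 4-cycle.\<close>
    let ?ns = "0 # a # (a - 1) # [x..<Suc b]"
    have "[length ?ns = i] (mod 4)"
      using True a5 ab xa a b a1 wx arcs_symmetric successively_segment[OF p b(2)]
      by (intro index_cycle_length[OF cyc p]) (auto simp: successively_Cons simp del: upt_Suc)
    moreover have "length ?ns = b - x + 4" using True by simp
    moreover have "(b - x) mod 4 = 0"
      using mod_eq_dvd_iff_nat[OF True, of 4] x4 b4 by simp
    ultimately show False using i by (simp only: cong_def mod_add_self2)
  next
    case False
    \<comment> \<open>The same cycle, with the segment between \<open>v x\<close> and
      \<open>v b\<close> run downwards.\<close>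
    let ?ns = "0 # a # (a - 1) # rev [b..<Suc x]"
    have ends: "hd (rev [b..<Suc x]) = x" "last (rev [b..<Suc x]) = b"
      using False by (simp_all add: hd_rev last_rev)
    have "[length ?ns = i] (mod 4)"
      using False a5 ab xa a b a1 wx x(2) arcs_symmetric successively_rev_segment[OF p x(2), of b]
      by (intro index_cycle_length[OF cyc p]) (auto simp: successively_Cons ends simp del: upt_Suc)
    moreover have "length ?ns = x - b + 4" using False by simp
    moreover have "(x - b) mod 4 = 0"
      using mod_eq_dvd_iff_nat[of b x 4] False x4 b4 by simp
    ultimately show False using i by (simp only: cong_def mod_add_self2)
  qed
qed

section \<open>Connected 2-regular graphs\<close>

text \<open>Reachability cannot leave \<open>S\<close>, and symmetry of the arcs turns connectedness
  into reachability of every vertex.\<close>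

lemma adjacent_closed_eq_verts:
  assumes conn: "connected (with_proj G)"
    and S: "S \<subseteq> pverts G" "S \<noteq> {}" "\<And>x y. x \<in> S \<Longrightarrow> (x, y) \<in> parcs G \<Longrightarrow> y \<in> S"
  shows "S = pverts G"
proof -
  have sc: "strongly_connected (with_proj G)"
    using symmetric_connected_imp_strongly_connected[OF pair_sym_arcs conn] .
  obtain s where s: "s \<in> S" using S by auto
  have "t \<in> S" if "t \<in> pverts G" for t
  proof -
    have "s \<rightarrow>\<^sup>*\<^bsub>with_proj G\<^esub> t" using sc s S(1) that by (auto simp: strongly_connected_def)
    then show ?thesis
      by (induction rule: reachable_induct) (use s S(3) in \<open>auto\<close>)
  qed
  then show ?thesis using S(1) by auto
qed

lemma two_neighbours:
  assumes "vertex_degree G u = 2" "(u, x) \<in> parcs G" "(u, y) \<in> parcs G" "x \<noteq> y"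
  shows "(u, w) \<in> parcs G \<longleftrightarrow> w = x \<or> w = y"
proof -
  have "{x, y} = {w. (u, w) \<in> parcs G}"
    using assms finite_neighbours by (intro card_subset_eq) (auto simp: vertex_degree_eq)
  then show ?thesis by auto
qed

text \<open>The second neighbour of \<open>v 0\<close> is some \<open>v a\<close> with
  \<open>a >= 2\<close>. If \<open>a < m\<close>, then \<open>v a\<close> would have the three
  neighbours \<open>v (a - 1)\<close>, \<open>v (a + 1)\<close> and \<open>v 0\<close>; so
  \<open>a = m\<close>. All neighbours now lie on the path, and connectedness makes it span.\<close>

lemma two_regular_cyclic_numbering:
  assumes conn: "connected (with_proj G)" and deg: "regular_of_degree G 2"
    and ne: "pverts G \<noteq> {}"
  obtains v m where "2 \<le> m" "path_on G v m" "v ` {..m} = pverts G" "(v 0, v m) \<in> parcs G"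
    "\<And>k w. k \<le> m \<Longrightarrow> (v k, w) \<in> parcs G \<longleftrightarrow>
       w = v (Suc k mod Suc m) \<or> w = v ((k + m) mod Suc m)"
proof -
  obtain v m where l: "longest_path G v m" using longest_path_exists ne by blast
  then have p: "path_on G v m" by (simp add: longest_path_def)
  have deg: "vertex_degree G (v k) = 2" if "k \<le> m" for k
    using that p deg by (auto simp: path_on_def regular_of_degree_def)
  have inj: "v j = v k \<longleftrightarrow> j = k" if "j \<le> m" "k \<le> m" for j k
    using p that by (auto simp: path_on_def inj_on_def)
  have "\<not> {w. (v 0, w) \<in> parcs G} \<subseteq> {v 1}"
    using deg[of 0] card_mono[of "{v 1}" "{w. (v 0, w) \<in> parcs G}"] by (auto simp: vertex_degree_eq)
  then obtain w where w: "(v 0, w) \<in> parcs G" "w \<noteq> v 1" by auto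
  then obtain a where a: "1 \<le> a" "a \<le> m" "w = v a" using longest_path_neighbour[OF l] by blast
  then have a2: "2 \<le> a" using w by (cases "a = 1") auto
  have "a = m"
  proof (rule ccontr)
    assume "a \<noteq> m"
    then have am: "a < m" using a by simp
    have "(v a, v (a - 1)) \<in> parcs G" "(v a, v (Suc a)) \<in> parcs G" "(v a, v 0) \<in> parcs G"
      using path_on_adjacent[OF p] am a w arcs_symmetric by auto
    moreover have "v (a - 1) \<noteq> v (Suc a)" "v 0 \<noteq> v (a - 1)" "v 0 \<noteq> v (Suc a)"
      using inj am a2 by auto
    ultimately show False using two_neighbours[OF deg[OF a(2)], of "v (a - 1)" "v (Suc a)" "v 0"]
      by auto
  qed
  then have m: "2 \<le> m" "(v 0, v m) \<in> parcs G" using a2 w a by auto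
  have nb: "(v k, w) \<in> parcs G \<longleftrightarrow> w = v (Suc k mod Suc m) \<or> w = v ((k + m) mod Suc m)"
    if k: "k \<le> m" for k w
  proof (rule two_neighbours[OF deg[OF k]])
    show "(v k, v (Suc k mod Suc m)) \<in> parcs G"
      using k m arcs_symmetric path_on_adjacent[OF p] by (cases "k = m") auto
    show "(v k, v ((k + m) mod Suc m)) \<in> parcs G"
      unfolding pred_mod_Suc[OF k] using k m path_on_adjacent[OF p] by auto
    \<comment> \<open>Successor and predecessor differ because the cycle has
      \<open>m + 1 >= 3\<close> vertices.\<close>
    show "v (Suc k mod Suc m) \<noteq> v ((k + m) mod Suc m)"
      unfolding pred_mod_Suc[OF k] using k m inj by (cases "k = m") auto
  qed
  have "v ` {..m} = pverts G"
  proof (rule adjacent_closed_eq_verts[OF conn])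
    show "v ` {..m} \<subseteq> pverts G" using p by (simp add: path_on_def)
    show "y \<in> v ` {..m}" if "x \<in> v ` {..m}" "(x, y) \<in> parcs G" for x y
      using that nb less_Suc_eq_le mod_less_divisor[of "Suc m"] by fastforce
  qed simp
  then show ?thesis using that m p nb by blast
qed

text \<open>The cyclic numbering itself is an isomorphism from the standard cycle to
  \<open>G\<close>, inverted at the end; its closing edge gives the cycle of length
  \<open>Suc m\<close> that fixes the residue.\<close>

lemma two_regular_iso_cycle_graph:
  assumes cyc: "\<And>p. undirected_cycle G p \<Longrightarrow> [length p = i] (mod 4)"
    and conn: "connected (with_proj G)" and deg: "regular_of_degree G 2"
    and ne: "pverts G \<noteq> {}"
  shows "\<exists>n\<ge>3. [n = i] (mod 4) \<and> digraph_iso (with_proj G) (with_proj (cycle_graph n))"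
proof -
  obtain v m where m: "2 \<le> m" and p: "path_on G v m" and im: "v ` {..m} = pverts G"
    and close: "(v 0, v m) \<in> parcs G"
    and nb: "\<And>k w. k \<le> m \<Longrightarrow> (v k, w) \<in> parcs G \<longleftrightarrow>
       w = v (Suc k mod Suc m) \<or> w = v ((k + m) mod Suc m)"
    by (rule two_regular_cyclic_numbering[OF conn deg ne], rule that)
  define H where "H = cycle_graph (Suc m)"
  have inj: "inj_on v {..<Suc m}" using p by (simp add: path_on_def lessThan_Suc_atMost)
  have H: "pverts H = {..<Suc m}" by (simp add: H_def cycle_graph_def)
  have arcs_H: "(j, k) \<in> parcs H \<longleftrightarrow>
      j \<le> m \<and> k \<le> m \<and> (k = Suc j mod Suc m \<or> k = (j + m) mod Suc m)" for j k
  proof -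
    \<comment> \<open>\<open>cycle_graph\<close> uses the successor in both directions; this
      converts one of them into the predecessor form of \<open>nb\<close>.\<close>
    have "j = Suc k mod Suc m \<longleftrightarrow> k = (j + m) mod Suc m" if "j \<le> m" "k \<le> m"
      unfolding pred_mod_Suc[OF that(1)] using that by (cases "k = m") auto
    then show ?thesis by (auto simp: H_def cycle_graph_def)
  qed
  interpret H: pair_graph H unfolding H_def using pair_graph_cycle_graph m by simp
  define f where "f = \<lparr>iso_verts = v, iso_arcs = map_prod v v, iso_head = snd, iso_tail = fst\<rparr>"
  have f: "H.digraph_isomorphism f"
    unfolding H.digraph_isomorphism_def
  proof (intro conjI)
    show "wf_digraph (with_proj H)" by unfold_locales
    show "inj_on (iso_verts f) (pverts H)" using inj by (simp add: f_def H)
    have "parcs H \<subseteq> {..<Suc m} \<times> {..<Suc m}" using arcs_H by auto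
    then show "inj_on (iso_arcs f) (parcs H)"
      unfolding f_def using map_prod_inj_on[OF inj inj] by (auto intro: inj_on_subset)
  qed (auto simp: f_def)
  have "map_prod v v ` parcs H = parcs G"
  proof (intro set_eqI iffI)
    fix e assume "e \<in> map_prod v v ` parcs H"
    then show "e \<in> parcs G" using nb by (auto simp: arcs_H)
  next
    fix e assume e: "e \<in> parcs G"
    obtain x y where xy: "e = (x, y)" by fastforce
    then obtain k where k: "k \<le> m" "x = v k" using e im in_arcsD1 by blast
    have "(v k, y) \<in> parcs G" using e xy k by simp
    then obtain l where l: "y = v l" "l = Suc k mod Suc m \<or> l = (k + m) mod Suc m"
      using nb[OF k(1)] by blast
    then have "l \<le> m" using less_Suc_eq_le by fastforce
    then have "(k, l) \<in> parcs H" using arcs_H k l by simp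
    then show "e \<in> map_prod v v ` parcs H" using xy k l by force
  qed
  then have "with_proj G = app_iso f (with_proj H)"
    using im by (simp add: app_iso_def f_def with_proj_def H lessThan_Suc_atMost)
  then have "digraph_iso (with_proj H) (with_proj G)"
    using f unfolding digraph_iso_def by blast
  then have "digraph_iso (with_proj G) (with_proj H)"
    using digraph_iso_swap H.wf_digraph_axioms by blast
  moreover have "[Suc m = i] (mod 4)"
    using chord_cycle_length[OF cyc p m _ close] by simp
  ultimately show ?thesis using m unfolding H_def by (intro exI[of _ "Suc m"]) auto
qed

text \<open>Isomorphisms preserve out-degrees, and \<open>n >= 3\<close> keeps the two cyclic
  neighbours of a vertex apart.\<close>

lemma iso_cycle_graph_two_regular:
  assumes n: "3 \<le> n" and iso: "digraph_iso (with_proj G) (with_proj (cycle_graph n))"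
  shows "regular_of_degree G 2"
proof -
  obtain f where f: "digraph_isomorphism f" "with_proj (cycle_graph n) = app_iso f (with_proj G)"
    using iso unfolding digraph_iso_def by blast
  have two: "vertex_degree (cycle_graph n) j = 2" if j: "j < n" for j
  proof -
    have "{k. (j, k) \<in> parcs (cycle_graph n)} = {Suc j mod n, if j = 0 then n - 1 else j - 1}"
      using j n by (auto simp: cycle_graph_def mod_Suc)
    moreover have "Suc j mod n \<noteq> (if j = 0 then n - 1 else j - 1)"
      using j n by (auto simp: mod_Suc)
    ultimately show ?thesis by (simp add: vertex_degree_eq)
  qed
  show ?thesis
    unfolding regular_of_degree_def
  proof
    fix u assume u: "u \<in> pverts G"
    have "verts (with_proj (cycle_graph n)) = iso_verts f ` pverts G"
      unfolding f(2) by simp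
    then have "iso_verts f u < n" using u by (auto simp: cycle_graph_def)
    then have "out_degree (app_iso f (with_proj G)) (iso_verts f u) = 2"
      using two f(2) by (simp add: vertex_degree_def)
    then show "vertex_degree G u = 2"
      using out_degree_app_iso_eq[OF f(1)] u by (simp add: vertex_degree_def)
  qed
qed

section \<open>Positive degrees and the characterisation\<close>

lemma connected_degree_pos:
  assumes "connected (with_proj G)" "1 < card (pverts G)" "u \<in> pverts G"
  shows "0 < vertex_degree G u"
proof (rule ccontr)
  assume "\<not> 0 < vertex_degree G u"
  then have "{w. (u, w) \<in> parcs G} = {}"
    using finite_neighbours by (simp add: vertex_degree_eq)
  \<comment> \<open>An isolated vertex is closed under adjacency on its own.\<close>
  then have "{u} = pverts G"
    using assms by (intro adjacent_closed_eq_verts) auto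
  then show False using assms(2) by (metis card.empty card.insert empty_iff finite.emptyI less_irrefl One_nat_def)
qed

end

text \<open>The one-vertex graph has no cycles, so it lies in every class, and it is regular of
  degree 0; \<open>nontrivial\<close> rules it out.\<close>

theorem theorem19:
  fixes G :: "'a pair_pre_digraph" and i :: nat
  assumes "i \<in> {0, 1, 2, 3}"
    and "G \<in> \<epsilon> i"
    and nontrivial: "card (pverts G) > 1"
  shows "(regular G \<longleftrightarrow> regular_of_degree G 2) \<and>
    (regular_of_degree G 2 \<longleftrightarrow>
      (\<exists>n\<ge>3. [n = i] (mod 4) \<and> digraph_iso (with_proj G) (with_proj (cycle_graph n))))"
proof -
  have conn: "connected (with_proj G)"
    and even: "\<And>u. u \<in> pverts G \<Longrightarrow> even (vertex_degree G u)"
    and cyc: "\<And>p. undirected_cycle G p \<Longrightarrow> [length p = i] (mod 4)"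
    using assms(2) by (auto simp: euler_class_def euler_graph_def)
  interpret pair_graph G using assms(2) by (simp add: euler_class_def euler_graph_def)
  have ne: "pverts G \<noteq> {}" using nontrivial by auto
  have "regular_of_degree G 2" if "regular_of_degree G k" for k
  proof -
    obtain u where u: "u \<in> pverts G" using ne by auto
    then have "even k" "0 < k"
      using that even connected_degree_pos[OF conn nontrivial] by (force simp: regular_of_degree_def)+
    moreover have "\<not> 3 \<le> k"
      using minimum_degree_3_contradiction[OF cyc _ ne] that by (auto simp: regular_of_degree_def)
    ultimately have "k = 2" by presburger
    then show ?thesis using that by simp
  qed
  then have "regular G \<longleftrightarrow> regular_of_degree G 2" unfolding regular_def by blast
  moreover have "regular_of_degree G 2 \<longleftrightarrow>
      (\<exists>n\<ge>3. [n = i] (mod 4) \<and> digraph_iso (with_proj G) (with_proj (cycle_graph n)))"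
    using two_regular_iso_cycle_graph[OF cyc conn _ ne] iso_cycle_graph_two_regular by blast
  ultimately show ?thesis by blast
qed

end
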